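(* Let $n\geq 2$ and let $\mathcal{L}_1,\dots,\mathcal{L}_n$ be finite collections of lines in $\mathbb{R}^n$ with $|\mathcal{L}_i|=L_i$, which are transversal: whenever $n$ lines, one from each $\mathcal{L}_i$, pass through a common point, their directions span $\mathbb{R}^n$. For $x\in\mathbb{R}^n$ let $N_i(x)$ be the number of lines of $\mathcal{L}_i$ passing through $x$. Then for every $\epsilon>0$ there is a constant $C$ (independent of the collections) such that \[\sum_{x}\Big(\prod_{i=1}^{n}N_i(x)\Big)^{\frac{1}{n-1}}\leq C\,(L_1\cdots L_n)^{\frac{1}{n-1}+\epsilon},\] where the sum is over all joints $x$, i.e. all points $x$ with $N_i(x)\geq 1$ for every $i$. *)

theory Defs
  imports "HOL-Analysis.Analysis"
begin

definition is_line :: "(real ^ 'n::finite) set \<Rightarrow> bool" where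
  "is_line l \<longleftrightarrow> affine l \<and> aff_dim l = 1"

text \<open>The direction of a line is represented by the one-dimensional linear subspace
  parallel to it, so that no direction vector has to be chosen.\<close>

definition direction :: "(real ^ 'n::finite) set \<Rightarrow> (real ^ 'n) set" where
  "direction l = {x - y |x y. x \<in> l \<and> y \<in> l}"

text \<open>A tuple of \<open>n\<close> collections of lines in \<open>n\<close>-dimensional space is indexed by the coordinate
  type \<open>'n\<close>, where \<open>n = CARD('n)\<close>.\<close>

definition transversal :: "('n::finite \<Rightarrow> (real ^ 'n) set set) \<Rightarrow> bool" where
  "transversal \<L> \<longleftrightarrow>
     (\<forall>l. (\<forall>i. l i \<in> \<L> i) \<and> (\<exists>x. \<forall>i. x \<in> l i) \<longrightarrow> span (\<Union>i. direction (l i)) = UNIV)"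

definition lines_through :: "(real ^ 'n::finite) set set \<Rightarrow> real ^ 'n \<Rightarrow> nat" where
  "lines_through S x = card {l \<in> S. x \<in> l}"

definition joints :: "('n::finite \<Rightarrow> (real ^ 'n) set set) \<Rightarrow> (real ^ 'n) set" where
  "joints \<L> = {x. \<forall>i. lines_through (\<L> i) x \<ge> 1}"

text \<open>A finite sum over an infinite set would be zero by convention; the following shows that
  the set of joints is finite, so that sums over it have their usual meaning.\<close>

lemma line_eq_affine_hull:
  assumes "is_line l" "x \<in> l" "y \<in> l" "x \<noteq> y"
  shows "l = affine hull {x, y}"
proof -
  have "affine hull {x, y} \<subseteq> l"
    using assms by (simp add: is_line_def hull_minimal)
  moreover have "aff_dim (affine hull {x, y}) = 1"
    using assms(4) by (simp add: aff_dim_2)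
  ultimately show ?thesis
    using assms(1) affine_dim_equal[of "affine hull {x, y}" l] by (simp add: is_line_def)
qed

lemma finite_joints:
  fixes \<L> :: "'n::finite \<Rightarrow> (real ^ 'n) set set"
  assumes n: "CARD('n) \<ge> 2" and fin: "\<And>i. finite (\<L> i)"
    and line: "\<And>i l. l \<in> \<L> i \<Longrightarrow> is_line l" and tr: "transversal \<L>"
  shows "finite (joints \<L>)"
proof -
  define P where "P = {(l, m). l \<in> (\<Union>i. \<L> i) \<and> m \<in> (\<Union>i. \<L> i) \<and> l \<noteq> m}"
  have "P \<subseteq> (\<Union>i. \<L> i) \<times> (\<Union>i. \<L> i)" by (auto simp: P_def)
  then have finP: "finite P" by (rule finite_subset) (simp add: fin)
  have one: "finite (l \<inter> m)" if "(l, m) \<in> P" for l m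
  proof -
    have lm: "is_line l" "is_line m" "l \<noteq> m" using that line by (auto simp: P_def)
    have "x = y" if "x \<in> l \<inter> m" "y \<in> l \<inter> m" for x y
      using line_eq_affine_hull[OF lm(1), of x y] line_eq_affine_hull[OF lm(2), of x y]
        lm(3) that by blast
    then have "l \<inter> m \<subseteq> {SOME x. x \<in> l \<inter> m}" by (metis insertI1 someI subsetI)
    then show ?thesis by (rule finite_subset) simp
  qed
  have "joints \<L> \<subseteq> (\<Union>(l, m)\<in>P. l \<inter> m)"
  proof
    fix x assume "x \<in> joints \<L>"
    then have "\<exists>l. l \<in> \<L> i \<and> x \<in> l" for i
      unfolding joints_def lines_through_def
      by (metis (mono_tags, lifting) card.empty empty_Collect_eq mem_Collect_eq not_one_le_zero)
    then obtain l where l: "\<And>i. l i \<in> \<L> i" "\<And>i. x \<in> l i" by metis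
    have sp: "span (\<Union>i. direction (l i)) = UNIV" using tr l unfolding transversal_def by blast
    have "\<exists>i j. l i \<noteq> l j"
    proof (rule ccontr)
      assume "\<not> ?thesis"
      then obtain m where m: "\<And>i. l i = m" by blast
      have "is_line m" "x \<in> m" using line l m by metis+
      have "direction m \<subseteq> span ((\<lambda>y. y - x) ` m)"
      proof
        fix z assume "z \<in> direction m"
        then obtain u v where "z = (u - x) - (v - x)" "u \<in> m" "v \<in> m"
          by (auto simp: direction_def)
        then show "z \<in> span ((\<lambda>y. y - x) ` m)"
          by (metis imageI span_base span_diff)
      qed
      then have "span ((\<lambda>y. y - x) ` m) = UNIV"
        using sp m by (metis (no_types, lifting) SUP_least span_minimal subspace_span top.extremum_uniqueI)
      then have "dim ((\<lambda>y. y - x) ` m) = CARD('n)"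
        by (metis DIM_cart DIM_real dim_UNIV dim_span mult.right_neutral)
      moreover have "aff_dim m = int (dim ((\<lambda>y. y - x) ` m))"
        using \<open>x \<in> m\<close> by (intro aff_dim_eq_dim_subtract hull_inc)
      ultimately show False using n \<open>is_line m\<close> by (simp add: is_line_def)
    qed
    then show "x \<in> (\<Union>(l, m)\<in>P. l \<inter> m)" using l unfolding P_def by blast
  qed
  moreover have "finite (\<Union>(l, m)\<in>P. l \<inter> m)" using finP one by auto
  ultimately show ?thesis by (rule finite_subset)
qed

end

theory Submission
  imports Defs "HOL-Computational_Algebra.Polynomial"
begin

text \<open>
  The bound holds even without the loss \<open>\<epsilon>\<close>, by the polynomial method with handicaps.
  Attach an integer handicap \<open>\<alpha>\<close> to every joint. Each line distributes slightly more than \<open>D\<close>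
  vanishing conditions among its joints: \<open>x\<close> receives the share \<open>max 0 (\<alpha> x + t)\<close>, where \<open>t\<close>
  depends on the line only. At each joint choose one line from every collection and write \<open>b\<^sub>i x\<close>
  for the shares. A polynomial of degree at most \<open>D\<close> whose Taylor coefficients in the box
  \<open>\<gamma> i < b\<^sub>i x\<close>, in the coordinates given by the chosen lines, vanish at every joint \<open>x\<close> is zero;
  counting dimensions, \<open>\<Sum>x. \<Prod>i. b\<^sub>i x\<close> is at least of order \<open>D\<close> to the power \<open>n\<close>. This holds for all
  handicaps, and raising the handicap of a joint raises its own shares and lowers the others, so a
  maximal choice of handicaps distributes the products \<open>\<Prod>i. b\<^sub>i x\<close> proportionally to any
  prescribed weights. With weights \<open>(\<Prod>i. N\<^sub>i x)\<close> to the power \<open>1 / (n - 1)\<close>, and each chosen line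
  being the one with the smallest share at \<open>x\<close>, the theorem follows from the AM-GM inequality and
  \<open>(\<Sum>x. N\<^sub>i x * b\<^sub>i x) \<le> L\<^sub>i * D\<close> up to lower order terms.
\<close>

section \<open>Polynomial functions\<close>

text \<open>Multivariate polynomials appear as functions of coordinates, so that a change of frame
  is plain composition. Coefficients are recovered by \<open>poly_fun_coeffs\<close>.\<close>

inductive poly_fun :: "nat \<Rightarrow> (('n::finite \<Rightarrow> real) \<Rightarrow> real) \<Rightarrow> bool" for D where
  monomial: "sum \<gamma> UNIV \<le> D \<Longrightarrow> poly_fun D (\<lambda>y. a * (\<Prod>i\<in>UNIV. y i ^ \<gamma> i))"
| add: "poly_fun D f \<Longrightarrow> poly_fun D g \<Longrightarrow> poly_fun D (\<lambda>y. f y + g y)"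

lemma poly_fun_mono: "poly_fun D f \<Longrightarrow> D \<le> D' \<Longrightarrow> poly_fun D' f"
  by (induction rule: poly_fun.induct) (auto intro: poly_fun.intros)

lemma poly_fun_cmult: "poly_fun D f \<Longrightarrow> poly_fun D (\<lambda>y. a * f y)"
proof (induction rule: poly_fun.induct)
  case (monomial \<gamma> b)
  then show ?case using poly_fun.monomial[of \<gamma> D "a * b"] by (simp add: mult.assoc)
next
  case (add f g)
  then show ?case using poly_fun.add[OF add.IH] by (simp add: distrib_left)
qed

lemma poly_fun_const: "poly_fun D (\<lambda>y. a)"
  using poly_fun.monomial[of "\<lambda>_. 0" D a] by simp

lemma poly_fun_sum: "finite S \<Longrightarrow> (\<And>k. k \<in> S \<Longrightarrow> poly_fun D (f k)) \<Longrightarrow> poly_fun D (\<lambda>y. \<Sum>k\<in>S. f k y)"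
  by (induction S rule: finite_induct) (auto intro: poly_fun_const poly_fun.add)

lemma poly_fun_times_coord: "poly_fun D f \<Longrightarrow> poly_fun (Suc D) (\<lambda>y. y j * f y)"
proof (induction rule: poly_fun.induct)
  case (monomial \<gamma> a)
  have "sum (\<gamma>(j := Suc (\<gamma> j))) UNIV = Suc (sum \<gamma> UNIV)"
    by (simp add: sum.remove[of UNIV j])
  moreover have "(\<Prod>i\<in>UNIV. y i ^ (\<gamma>(j := Suc (\<gamma> j))) i) = y j * (\<Prod>i\<in>UNIV. y i ^ \<gamma> i)" for y :: "'a \<Rightarrow> real"
    by (simp add: prod.remove[of UNIV j])
  ultimately show ?case
    using poly_fun.monomial[of "\<gamma>(j := Suc (\<gamma> j))" "Suc D" a] monomial by (simp add: algebra_simps)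
next
  case (add f g)
  then show ?case using poly_fun.add[OF add.IH] by (simp add: distrib_left)
qed

lemma poly_fun_times_affine:
  assumes "poly_fun D f"
  shows "poly_fun (Suc D) (\<lambda>y. (a + (\<Sum>j\<in>UNIV. y j * w j)) * f y)"
proof -
  have "poly_fun (Suc D) (\<lambda>y. a * f y + (\<Sum>j\<in>UNIV. w j * (y j * f y)))"
    using assms by (intro poly_fun.add poly_fun_sum poly_fun_cmult poly_fun_times_coord finite)
      (auto intro: poly_fun_mono)
  then show ?thesis
    by (simp add: distrib_right sum_distrib_right mult.assoc mult.left_commute)
qed

lemma poly_fun_times_affine_power:
  assumes "poly_fun D f"
  shows "poly_fun (k + D) (\<lambda>y. (a + (\<Sum>j\<in>UNIV. y j * w j)) ^ k * f y)"
proof (induction k)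
  case (Suc k)
  then show ?case using poly_fun_times_affine[of "k + D" _ a w] by (simp add: mult.assoc)
qed (use assms in simp)

text \<open>Each coordinate turns into an affine form, so a monomial turns into a product of as many
  affine forms as its degree.\<close>

lemma poly_fun_affine_comp:
  assumes "poly_fun D f"
  shows "poly_fun D (\<lambda>y. f (\<lambda>i. p i + (\<Sum>j\<in>UNIV. y j * w j i)))"
  using assms
proof (induction rule: poly_fun.induct)
  case (monomial \<gamma> a)
  have "poly_fun (sum \<gamma> A) (\<lambda>y. \<Prod>i\<in>A. (p i + (\<Sum>j\<in>UNIV. y j * w j i)) ^ \<gamma> i)" if "finite A" for A
    using that
  proof (induction A rule: finite_induct)
    case (insert i A)
    then show ?case
      using poly_fun_times_affine_power[OF insert.IH, of "\<gamma> i" "p i" "\<lambda>j. w j i"] by simp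
  qed (simp add: poly_fun_const)
  from poly_fun_cmult[OF poly_fun_mono[OF this monomial]] show ?case by simp
qed (auto intro: poly_fun.add)

section \<open>Coefficients of polynomial functions and their uniqueness\<close>

definition multidegrees :: "nat \<Rightarrow> ('n::finite \<Rightarrow> nat) set" where
  "multidegrees D = {\<gamma>. sum \<gamma> UNIV \<le> D}"

lemma finite_bounded_funs: "finite {\<gamma> :: 'n::finite \<Rightarrow> nat. \<forall>i. \<gamma> i < b i}"
proof -
  have "{\<gamma> :: 'n \<Rightarrow> nat. \<forall>i. \<gamma> i < b i} = PiE UNIV (\<lambda>i. {..<b i})"
    by (auto simp: PiE_def extensional_def)
  then show ?thesis by (simp add: finite_PiE)
qed

lemma card_bounded_funs: "card {\<gamma> :: 'n::finite \<Rightarrow> nat. \<forall>i. \<gamma> i < b i} = (\<Prod>i\<in>UNIV. b i)"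
proof -
  have "{\<gamma> :: 'n \<Rightarrow> nat. \<forall>i. \<gamma> i < b i} = PiE UNIV (\<lambda>i. {..<b i})"
    by (auto simp: PiE_def extensional_def)
  then show ?thesis by (simp add: card_PiE)
qed

lemma multidegree_le: "\<gamma> \<in> multidegrees D \<Longrightarrow> \<gamma> i \<le> D"
  using member_le_sum[of i UNIV \<gamma>] by (simp add: multidegrees_def)

lemma finite_multidegrees: "finite (multidegrees D :: ('n::finite \<Rightarrow> nat) set)"
  by (rule finite_subset[OF _ finite_bounded_funs[of "\<lambda>_. Suc D"]])
    (auto simp: less_Suc_eq_le multidegree_le)

lemma poly_fun_coeffs:
  assumes "poly_fun D f"
  shows "\<exists>c. \<forall>y. f y = (\<Sum>\<gamma>\<in>multidegrees D. c \<gamma> * (\<Prod>i\<in>UNIV. y i ^ \<gamma> i))"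
  using assms
proof (induction rule: poly_fun.induct)
  case (monomial \<gamma> a)
  then show ?case
    by (intro exI[of _ "\<lambda>\<delta>. if \<delta> = \<gamma> then a else 0"])
      (simp add: multidegrees_def if_distrib[of "\<lambda>x. x * _"] finite_multidegrees[unfolded multidegrees_def] cong: if_cong)
next
  case (add f g)
  obtain c where "\<forall>y. f y = (\<Sum>\<gamma>\<in>multidegrees D. c \<gamma> * (\<Prod>i\<in>UNIV. y i ^ \<gamma> i))"
    using add.IH(1) by blast
  moreover obtain d where "\<forall>y. g y = (\<Sum>\<gamma>\<in>multidegrees D. d \<gamma> * (\<Prod>i\<in>UNIV. y i ^ \<gamma> i))"
    using add.IH(2) by blast
  ultimately show ?case
    by (intro exI[of _ "\<lambda>\<delta>. c \<delta> + d \<delta>"]) (simp add: distrib_right sum.distrib)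
qed

text \<open>One variable is split off at a time: as a polynomial in \<open>y a\<close> the sum
  vanishes identically, hence so does each of its coefficients. Admitting a proper subset
  \<open>A\<close> of the variables lets \<open>vanishing_on_line\<close> compare coefficients in
  all directions but one.\<close>

lemma sum_monomials_eq_0:
  fixes c :: "('n \<Rightarrow> nat) \<Rightarrow> real"
  assumes "finite A" "finite G" "\<And>y. (\<Sum>\<gamma>\<in>G. c \<gamma> * (\<Prod>i\<in>A. y i ^ \<gamma> i)) = 0"
  shows "(\<Sum>\<gamma> | \<gamma> \<in> G \<and> (\<forall>i\<in>A. \<gamma> i = \<delta> i). c \<gamma>) = 0"
  using assms
proof (induction A arbitrary: G rule: finite_induct)
  case (insert a A)
  let ?G = "{\<gamma> \<in> G. \<gamma> a = \<delta> a}"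
  have "(\<Sum>\<gamma>\<in>?G. c \<gamma> * (\<Prod>i\<in>A. y i ^ \<gamma> i)) = 0" for y
  proof -
    let ?p = "\<Sum>\<gamma>\<in>G. monom (c \<gamma> * (\<Prod>i\<in>A. y i ^ \<gamma> i)) (\<gamma> a)"
    have "poly ?p t = 0" for t
    proof -
      have "(\<Prod>i\<in>A. (y(a := t)) i ^ \<gamma> i) = (\<Prod>i\<in>A. y i ^ \<gamma> i)" for \<gamma> :: "'n \<Rightarrow> nat"
        using insert.hyps by (intro prod.cong) auto
      then have "poly ?p t = (\<Sum>\<gamma>\<in>G. c \<gamma> * (\<Prod>i\<in>insert a A. (y(a := t)) i ^ \<gamma> i))"
        using insert.hyps by (simp add: poly_sum poly_monom mult_ac)
      then show ?thesis using insert.prems by simp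
    qed
    then have "?p = 0" using poly_all_0_iff_0 by blast
    then have "coeff ?p (\<delta> a) = 0" by simp
    then show ?thesis
      using insert.prems(1) by (simp add: coeff_sum sum.inter_filter)
  qed
  from insert.IH[OF _ this] insert.prems(1)
  have "(\<Sum>\<gamma> | \<gamma> \<in> ?G \<and> (\<forall>i\<in>A. \<gamma> i = \<delta> i). c \<gamma>) = 0" by simp
  then show ?case by (simp add: conj_ac)
qed simp

lemma monomials_independent:
  fixes c :: "('n::finite \<Rightarrow> nat) \<Rightarrow> real"
  assumes "finite G" "\<And>y. (\<Sum>\<gamma>\<in>G. c \<gamma> * (\<Prod>i\<in>UNIV. y i ^ \<gamma> i)) = 0" "\<delta> \<in> G"
  shows "c \<delta> = 0"
proof -
  have "{\<gamma>. \<gamma> \<in> G \<and> (\<forall>i\<in>UNIV. \<gamma> i = \<delta> i)} = {\<delta>}" using assms(3) by auto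
  then show ?thesis using sum_monomials_eq_0[OF finite assms(1,2), of \<delta>] by simp
qed

section \<open>Homogeneous linear systems with more unknowns than equations\<close>

lemma homogeneous_system_solution:
  fixes A :: "'k \<Rightarrow> 'b \<Rightarrow> real"
  assumes "finite K" "finite B" "card K < card B"
  shows "\<exists>a. (\<exists>b\<in>B. a b \<noteq> 0) \<and> (\<forall>k\<in>K. (\<Sum>b\<in>B. A k b * a b) = 0)"
  using assms
proof (induction K arbitrary: A B rule: finite_induct)
  case empty
  then have "B \<noteq> {}" by auto
  then show ?case by (intro exI[of _ "\<lambda>_. 1"]) auto
next
  case (insert k K)
  show ?case
  proof (cases "\<forall>b\<in>B. A k b = 0")
    case True
    have "card K < card B" using insert by simp
    from insert.IH[OF insert.prems(1) this, of A]
    obtain a where "\<exists>b\<in>B. a b \<noteq> 0" "\<forall>k\<in>K. (\<Sum>b\<in>B. A k b * a b) = 0" by blast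
    then show ?thesis using True by (intro exI[of _ a]) simp
  next
    case False
    then obtain b0 where b0: "b0 \<in> B" "A k b0 \<noteq> 0" by blast
    \<comment> \<open>Gaussian elimination: equation \<open>k\<close>, with pivot \<open>b0\<close>,
      removes this unknown from the other equations and afterwards determines its value.\<close>
    let ?B = "B - {b0}" and ?A = "\<lambda>k' b. A k' b - A k' b0 * A k b / A k b0"
    have "finite ?B" "card K < card ?B" using insert b0 by auto
    from insert.IH[OF this, of ?A] obtain a where a: "\<exists>b\<in>?B. a b \<noteq> 0"
      "\<forall>k\<in>K. (\<Sum>b\<in>?B. ?A k b * a b) = 0" by blast
    define a' where "a' = a(b0 := - (\<Sum>b\<in>?B. A k b * a b) / A k b0)"
    have split: "(\<Sum>b\<in>B. A k' b * a' b) = A k' b0 * a' b0 + (\<Sum>b\<in>?B. A k' b * a b)" for k'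
      using insert.prems(1) b0 by (simp add: sum.remove[of B b0] a'_def)
    have "(\<Sum>b\<in>B. A k' b * a' b) = 0" if "k' \<in> K" for k'
    proof -
      have "0 = (\<Sum>b\<in>?B. ?A k' b * a b)" using a(2) that by simp
      also have "\<dots> = (\<Sum>b\<in>?B. A k' b * a b) - A k' b0 / A k b0 * (\<Sum>b\<in>?B. A k b * a b)"
        by (simp add: left_diff_distrib sum_subtractf sum_distrib_left mult.assoc)
      finally show ?thesis unfolding split by (simp add: a'_def)
    qed
    moreover have "(\<Sum>b\<in>B. A k b * a' b) = 0" unfolding split using b0 by (simp add: a'_def)
    moreover have "\<exists>b\<in>B. a' b \<noteq> 0" using a(1) by (auto simp: a'_def)
    ultimately show ?thesis by blast
  qed
qed

section \<open>Vanishing orders and the dimension bound\<close>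

text \<open>Divisibility by \<open>s ^ m\<close> is demanded along every line through
  \<open>x\<close>, so no frame enters. An order read off in the frame of one joint can therefore be
  used in the frame of another.\<close>

definition vanishes_to_order :: "(('n::finite \<Rightarrow> real) \<Rightarrow> real) \<Rightarrow> real ^ 'n \<Rightarrow> nat \<Rightarrow> bool" where
  "vanishes_to_order f x m \<longleftrightarrow> (\<forall>z. \<exists>q. \<forall>s. f (($) (x + s *\<^sub>R z)) = s ^ m * poly q s)"

text \<open>The Taylor expansion of \<open>f\<close> at \<open>x\<close> in the frame
  \<open>v\<close>; the values of \<open>c\<close> outside \<open>multidegrees D\<close> are left
  free.\<close>

definition local_coeffs ::
  "nat \<Rightarrow> (('n::finite \<Rightarrow> real) \<Rightarrow> real) \<Rightarrow> real ^ 'n \<Rightarrow> ('n \<Rightarrow> real ^ 'n) \<Rightarrow> (('n \<Rightarrow> nat) \<Rightarrow> real) \<Rightarrow> bool" where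
  "local_coeffs D f x v c \<longleftrightarrow> (\<forall>y. f (($) (x + (\<Sum>j\<in>UNIV. y j *\<^sub>R v j))) =
     (\<Sum>\<gamma>\<in>multidegrees D. c \<gamma> * (\<Prod>i\<in>UNIV. y i ^ \<gamma> i)))"

lemma local_coeffs_exist:
  assumes "poly_fun D f"
  shows "\<exists>c. local_coeffs D f x v c"
proof -
  have "(($) (x + (\<Sum>j\<in>UNIV. y j *\<^sub>R v j))) = (\<lambda>i. x $ i + (\<Sum>j\<in>UNIV. y j * v j $ i))" for y
    by (simp add: fun_eq_iff)
  then show ?thesis
    using poly_fun_coeffs[OF poly_fun_affine_comp[OF assms, of "($) x" "\<lambda>j. ($) (v j)"]]
    unfolding local_coeffs_def by simp
qed

text \<open>On a line through \<open>x\<close>, the homogeneous part of degree \<open>d\<close>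
  becomes the coefficient of \<open>s ^ d\<close>. For \<open>d < m\<close> it is zero for all
  \<open>y\<close>, and independence of the monomials kills its coefficients.\<close>

lemma vanishing_local_coeffs:
  fixes f :: "('n::finite \<Rightarrow> real) \<Rightarrow> real"
  assumes c: "local_coeffs D f x v c" and f: "vanishes_to_order f x m"
    and \<gamma>: "\<gamma> \<in> multidegrees D" "sum \<gamma> UNIV < m"
  shows "c \<gamma> = 0"
proof -
  let ?G = "{\<delta> \<in> multidegrees D. sum \<delta> UNIV = sum \<gamma> UNIV}"
  have "(\<Sum>\<delta>\<in>?G. c \<delta> * (\<Prod>i\<in>UNIV. y i ^ \<delta> i)) = 0" for y :: "'n \<Rightarrow> real"
  proof -
    let ?p = "\<Sum>\<delta>\<in>multidegrees D. monom (c \<delta> * (\<Prod>i\<in>UNIV. y i ^ \<delta> i)) (sum \<delta> UNIV)"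
    obtain q where q: "\<forall>s. f (($) (x + s *\<^sub>R (\<Sum>j\<in>UNIV. y j *\<^sub>R v j))) = s ^ m * poly q s"
      using f unfolding vanishes_to_order_def by blast
    have "poly ?p s = poly (monom 1 m * q) s" for s
    proof -
      have "poly ?p s = (\<Sum>\<delta>\<in>multidegrees D. c \<delta> * (\<Prod>i\<in>UNIV. (s * y i) ^ \<delta> i))"
        by (simp add: poly_sum poly_monom power_mult_distrib prod.distrib power_sum mult_ac)
      also have "\<dots> = f (($) (x + (\<Sum>j\<in>UNIV. (s * y j) *\<^sub>R v j)))"
        using c by (simp add: local_coeffs_def)
      also have "(\<Sum>j\<in>UNIV. (s * y j) *\<^sub>R v j) = s *\<^sub>R (\<Sum>j\<in>UNIV. y j *\<^sub>R v j)"
        by (simp add: scaleR_sum_right)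
      finally show ?thesis using q by (simp only: poly_mult poly_monom mult_1)
    qed
    then have "?p = monom 1 m * q" by (intro iffD1[OF poly_eq_poly_eq_iff] ext)
    then have "coeff ?p (sum \<gamma> UNIV) = 0" using \<gamma>(2) by (simp add: coeff_monom_mult)
    then show ?thesis
      by (simp add: coeff_sum sum.inter_filter finite_multidegrees)
  qed
  from monomials_independent[OF _ this, of \<gamma>] \<gamma>(1) show ?thesis
    by (simp add: finite_multidegrees)
qed

text \<open>Since the frame spans, every line through \<open>x\<close> is visible in the
  coordinates, and each surviving term contains \<open>s ^ m\<close>.\<close>

lemma vanishes_to_order_if_local_coeffs:
  fixes f :: "('n::finite \<Rightarrow> real) \<Rightarrow> real"
  assumes c: "local_coeffs D f x v c" and v: "\<And>z. \<exists>y. z = (\<Sum>j\<in>UNIV. y j *\<^sub>R v j)"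
    and c0: "\<And>\<gamma>. \<gamma> \<in> multidegrees D \<Longrightarrow> sum \<gamma> UNIV < m \<Longrightarrow> c \<gamma> = 0"
  shows "vanishes_to_order f x m"
  unfolding vanishes_to_order_def
proof
  fix z
  obtain y where z: "z = (\<Sum>j\<in>UNIV. y j *\<^sub>R v j)" using v by blast
  let ?q = "\<Sum>\<delta>\<in>multidegrees D. monom (c \<delta> * (\<Prod>i\<in>UNIV. y i ^ \<delta> i)) (sum \<delta> UNIV - m)"
  have "f (($) (x + s *\<^sub>R z)) = s ^ m * poly ?q s" for s
  proof -
    have "s *\<^sub>R z = (\<Sum>j\<in>UNIV. (s * y j) *\<^sub>R v j)" by (simp add: z scaleR_sum_right)
    then have "f (($) (x + s *\<^sub>R z)) = (\<Sum>\<delta>\<in>multidegrees D. c \<delta> * (\<Prod>i\<in>UNIV. (s * y i) ^ \<delta> i))"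
      using c by (simp add: local_coeffs_def)
    also have "\<dots> = (\<Sum>\<delta>\<in>multidegrees D. s ^ m * (c \<delta> * (\<Prod>i\<in>UNIV. y i ^ \<delta> i) * s ^ (sum \<delta> UNIV - m)))"
    proof (rule sum.cong[OF refl])
      fix \<delta> :: "'n \<Rightarrow> nat" assume "\<delta> \<in> multidegrees D"
      show "c \<delta> * (\<Prod>i\<in>UNIV. (s * y i) ^ \<delta> i) = s ^ m * (c \<delta> * (\<Prod>i\<in>UNIV. y i ^ \<delta> i) * s ^ (sum \<delta> UNIV - m))"
      proof (cases "sum \<delta> UNIV < m")
        case True
        then show ?thesis using c0 \<open>\<delta> \<in> multidegrees D\<close> by simp
      next
        case False
        then have "s ^ sum \<delta> UNIV = s ^ m * s ^ (sum \<delta> UNIV - m)" by (simp flip: power_add)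
        moreover have "(\<Prod>i\<in>UNIV. (s * y i) ^ \<delta> i) = s ^ sum \<delta> UNIV * (\<Prod>i\<in>UNIV. y i ^ \<delta> i)"
          by (simp add: power_mult_distrib prod.distrib power_sum)
        ultimately show ?thesis by simp
      qed
    qed
    finally show ?thesis by (simp add: poly_sum poly_monom sum_distrib_left)
  qed
  then show "\<exists>q. \<forall>s. f (($) (x + s *\<^sub>R z)) = s ^ m * poly q s" by blast
qed

text \<open>A nonzero coefficient of least total degree works. One exists because the frame spans,
  so that \<open>f\<close> would otherwise be zero everywhere.\<close>

lemma leading_local_coeff:
  fixes f :: "('n::finite \<Rightarrow> real) \<Rightarrow> real"
  assumes c: "local_coeffs D f x v c" and v: "\<And>z. \<exists>y. z = (\<Sum>j\<in>UNIV. y j *\<^sub>R v j)"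
    and f: "\<exists>y. f y \<noteq> 0"
  shows "\<exists>\<gamma>\<in>multidegrees D. c \<gamma> \<noteq> 0 \<and> vanishes_to_order f x (sum \<gamma> UNIV)"
proof -
  obtain y0 where y0: "f y0 \<noteq> 0" using f by blast
  have "\<exists>\<gamma>\<in>multidegrees D. c \<gamma> \<noteq> 0"
  proof (rule ccontr)
    assume "\<not> ?thesis"
    then have zero: "f (($) (x + (\<Sum>j\<in>UNIV. y j *\<^sub>R v j))) = 0" for y
      using c by (simp add: local_coeffs_def)
    obtain y where "(\<chi> i. y0 i) - x = (\<Sum>j\<in>UNIV. y j *\<^sub>R v j)" using v by blast
    then have "x + (\<Sum>j\<in>UNIV. y j *\<^sub>R v j) = (\<chi> i. y0 i)" by (simp add: algebra_simps)
    with zero[of y] have "f (($) (\<chi> i. y0 i)) = 0" by simp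
    moreover have "($) (\<chi> i. y0 i) = y0" by (simp add: fun_eq_iff)
    ultimately show False using y0 by simp
  qed
  then obtain \<gamma> where \<gamma>: "\<gamma> \<in> multidegrees D \<and> c \<gamma> \<noteq> 0"
    "\<And>\<delta>. \<delta> \<in> multidegrees D \<and> c \<delta> \<noteq> 0 \<Longrightarrow> sum \<gamma> UNIV \<le> sum \<delta> UNIV"
    using ex_has_least_nat[of "\<lambda>\<gamma>. \<gamma> \<in> multidegrees D \<and> c \<gamma> \<noteq> 0" _ "\<lambda>\<gamma>. sum \<gamma> UNIV"] by blast
  have "vanishes_to_order f x (sum \<gamma> UNIV)"
    by (rule vanishes_to_order_if_local_coeffs[OF c v]) (use \<gamma>(2) in \<open>fastforce simp: not_less[symmetric]\<close>)
  then show ?thesis using \<gamma> by blast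
qed

text \<open>The sum is the coefficient of the monomial \<open>\<delta>\<close> in the directions
  other than \<open>i\<close>, viewed as a polynomial along the line. Like a transverse derivative
  of order \<open>sum \<delta> (UNIV - {i})\<close>, it loses at most that much of the order
  \<open>m\<close>. Truncated subtraction makes the claim trivial when nothing remains.\<close>

lemma vanishing_on_line:
  fixes f :: "('n::finite \<Rightarrow> real) \<Rightarrow> real" and \<delta> :: "'n \<Rightarrow> nat"
  assumes c: "local_coeffs D f x v c" and f: "poly_fun D f"
    and van: "vanishes_to_order f (x + s0 *\<^sub>R v i) m"
  shows "[:- s0, 1:] ^ (m - sum \<delta> (UNIV - {i})) dvd
    (\<Sum>\<gamma> | \<gamma> \<in> multidegrees D \<and> (\<forall>j\<in>UNIV - {i}. \<gamma> j = \<delta> j). monom (c \<gamma>) (\<gamma> i))"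
proof -
  let ?H = "{\<gamma>. \<gamma> \<in> multidegrees D \<and> (\<forall>j\<in>UNIV - {i}. \<gamma> j = \<delta> j)}"
  let ?h = "\<Sum>\<gamma>\<in>?H. monom (c \<gamma>) (\<gamma> i)" and ?r = "m - sum \<delta> (UNIV - {i})"
  obtain c' where c': "local_coeffs D f (x + s0 *\<^sub>R v i) v c'"
    using local_coeffs_exist[OF f] by blast
  let ?q = "\<Sum>\<gamma>\<in>?H. monom (c' \<gamma>) (\<gamma> i - ?r)"
  have upd: "(\<Prod>j\<in>UNIV. (y(i := u)) j ^ \<gamma> j) = u ^ \<gamma> i * (\<Prod>j\<in>UNIV - {i}. y j ^ \<gamma> j)"
    for y and u :: real and \<gamma> :: "'n \<Rightarrow> nat"
    by (simp add: prod.remove[of UNIV i])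
  have shift: "poly ?h (s + s0) = s ^ ?r * poly ?q s" for s
  proof -
    \<comment> \<open>The expansions about the two centres are compared at the same point:
      coordinate \<open>i\<close> differs by \<open>s0\<close>, the others coincide.\<close>
    have "(\<Sum>\<gamma>\<in>multidegrees D. (c' \<gamma> * s ^ \<gamma> i - c \<gamma> * (s + s0) ^ \<gamma> i) * (\<Prod>j\<in>UNIV - {i}. y j ^ \<gamma> j)) = 0" for y
    proof -
      have "x + s0 *\<^sub>R v i + (\<Sum>j\<in>UNIV. (y(i := s)) j *\<^sub>R v j) = x + (\<Sum>j\<in>UNIV. (y(i := s + s0)) j *\<^sub>R v j)"
        by (simp add: sum.remove[of UNIV i] scaleR_add_left)
      then have "(\<Sum>\<gamma>\<in>multidegrees D. c' \<gamma> * (\<Prod>j\<in>UNIV. (y(i := s)) j ^ \<gamma> j)) =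
          (\<Sum>\<gamma>\<in>multidegrees D. c \<gamma> * (\<Prod>j\<in>UNIV. (y(i := s + s0)) j ^ \<gamma> j))"
        using c[unfolded local_coeffs_def, rule_format, of "y(i := s + s0)"]
          c'[unfolded local_coeffs_def, rule_format, of "y(i := s)"] by (simp only:)
      then show ?thesis unfolding upd by (simp add: left_diff_distrib sum_subtractf mult.assoc)
    qed
    from sum_monomials_eq_0[OF _ finite_multidegrees this, of \<delta>]
    have "(\<Sum>\<gamma>\<in>?H. c \<gamma> * (s + s0) ^ \<gamma> i) = (\<Sum>\<gamma>\<in>?H. c' \<gamma> * s ^ \<gamma> i)"
      by (simp add: sum_subtractf)
    also have "\<dots> = (\<Sum>\<gamma>\<in>?H. s ^ ?r * (c' \<gamma> * s ^ (\<gamma> i - ?r)))"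
    proof (rule sum.cong[OF refl])
      fix \<gamma> assume \<gamma>: "\<gamma> \<in> ?H"
      have sum: "sum \<gamma> UNIV = \<gamma> i + sum \<delta> (UNIV - {i})"
        using \<gamma> by (simp add: sum.remove[of UNIV i])
      show "c' \<gamma> * s ^ \<gamma> i = s ^ ?r * (c' \<gamma> * s ^ (\<gamma> i - ?r))"
      proof (cases "sum \<gamma> UNIV < m")
        case True
        then show ?thesis using vanishing_local_coeffs[OF c' van] \<gamma> by simp
      next
        case False
        then have "?r \<le> \<gamma> i" using sum by linarith
        then have "s ^ \<gamma> i = s ^ ?r * s ^ (\<gamma> i - ?r)" by (simp flip: power_add)
        then show ?thesis by simp
      qed
    qed
    finally show ?thesis by (simp add: poly_sum poly_monom sum_distrib_left)
  qed
  have "poly ?h u = poly ([:- s0, 1:] ^ ?r * pcompose ?q [:- s0, 1:]) u" for u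
    using shift[of "u - s0"] by (simp add: poly_pcompose)
  then have "?h = [:- s0, 1:] ^ ?r * pcompose ?q [:- s0, 1:]" by (intro iffD1[OF poly_eq_poly_eq_iff] ext)
  then show ?thesis by (rule dvdI)
qed

section \<open>Counting zeros and counting conditions\<close>

lemma sum_root_orders_le_degree:
  fixes h :: "real poly"
  assumes "h \<noteq> 0" "finite S" "inj_on r S" "\<And>x. x \<in> S \<Longrightarrow> [:- r x, 1:] ^ k x dvd h"
  shows "sum k S \<le> degree h"
proof -
  have "sum k S \<le> (\<Sum>x\<in>S. order (r x) h)"
    using assms(1,4) by (intro sum_mono) (metis order_divides)
  also have "\<dots> = (\<Sum>a\<in>r ` S. order a h)"
    using assms(3) by (simp add: sum.reindex)
  also have "\<dots> = (\<Sum>a\<in>{a \<in> r ` S. poly h a = 0}. order a h)"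
    using assms(2) by (intro sum.mono_neutral_right) (auto simp: order_0I)
  also have "\<dots> \<le> (\<Sum>a | poly h a = 0. order a h)"
    using assms(1) by (intro sum_mono2 poly_roots_finite) auto
  also have "\<dots> \<le> degree h"
    using assms(1) by (rule sum_order_le_degree)
  finally show ?thesis .
qed

text \<open>The conditions are linear in the coefficients of \<open>f\<close>. Only monomials with
  all exponents at most \<open>E\<close> are used: their degree is at most
  \<open>CARD('n) * E\<close>, and their number is exactly the power in \<open>less\<close>.\<close>

lemma polynomial_with_vanishing_local_coeffs:
  fixes U :: "(real ^ 'n::finite) set" and v :: "real ^ 'n \<Rightarrow> 'n \<Rightarrow> real ^ 'n" and b :: "real ^ 'n \<Rightarrow> 'n \<Rightarrow> nat"
  assumes U: "finite U" and D: "CARD('n) * E \<le> D"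
    and less: "(\<Sum>x\<in>U. \<Prod>i\<in>UNIV. b x i) < (E + 1) ^ CARD('n)"
  shows "\<exists>f c. poly_fun D f \<and> (\<exists>y. f y \<noteq> 0) \<and> (\<forall>x\<in>U. local_coeffs D f x (v x) (c x)) \<and>
    (\<forall>x\<in>U. \<forall>\<gamma>. (\<forall>i. \<gamma> i < b x i) \<longrightarrow> c x \<gamma> = 0)"
proof -
  define B where "B = {\<mu> :: 'n \<Rightarrow> nat. \<forall>i. \<mu> i < E + 1}"
  define K where "K = (SIGMA x:U. {\<gamma> :: 'n \<Rightarrow> nat. \<forall>i. \<gamma> i < b x i})"
  let ?m = "\<lambda>\<mu> y. \<Prod>i\<in>UNIV. y i ^ \<mu> i :: real"
  have fin: "finite B" "finite K" using U by (simp_all add: B_def K_def finite_bounded_funs del: Suc_eq_plus1 add_Suc_right)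
  have pm: "poly_fun D (?m \<mu>)" if "\<mu> \<in> B" for \<mu>
  proof -
    have "sum \<mu> UNIV \<le> (\<Sum>i\<in>(UNIV::'n set). E)" using that by (intro sum_mono) (auto simp: B_def less_Suc_eq_le)
    then show ?thesis using poly_fun.monomial[of \<mu> D 1] D by simp
  qed
  have "\<forall>x. \<forall>\<mu>\<in>B. \<exists>c. local_coeffs D (?m \<mu>) x (v x) c"
    using local_coeffs_exist[OF pm] by blast
  then obtain C where C: "\<And>x \<mu>. \<mu> \<in> B \<Longrightarrow> local_coeffs D (?m \<mu>) x (v x) (C x \<mu>)"
    by metis
  have "card K < card B"
    using less U unfolding K_def B_def by (simp add: card_SigmaI finite_bounded_funs card_bounded_funs)
  from homogeneous_system_solution[OF fin(2,1) this, of "\<lambda>(x, \<gamma>) \<mu>. C x \<mu> \<gamma>"]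
  obtain a where a: "\<exists>\<mu>\<in>B. a \<mu> \<noteq> 0" "\<forall>k\<in>K. (\<Sum>\<mu>\<in>B. (case k of (x, \<gamma>) \<Rightarrow> \<lambda>\<mu>. C x \<mu> \<gamma>) \<mu> * a \<mu>) = 0"
    by blast
  define f where "f y = (\<Sum>\<mu>\<in>B. a \<mu> * ?m \<mu> y)" for y
  define c where "c x \<gamma> = (\<Sum>\<mu>\<in>B. a \<mu> * C x \<mu> \<gamma>)" for x \<gamma>
  have "poly_fun D f" unfolding f_def
    by (intro poly_fun_sum poly_fun_cmult pm fin)
  moreover have "\<exists>y. f y \<noteq> 0"
    using monomials_independent[OF fin(1), of a] a(1) unfolding f_def by blast
  moreover have "local_coeffs D f x (v x) (c x)" for x
    unfolding local_coeffs_def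
  proof
    fix y
    have "f (($) (x + (\<Sum>j\<in>UNIV. y j *\<^sub>R v x j))) =
        (\<Sum>\<mu>\<in>B. a \<mu> * (\<Sum>\<gamma>\<in>multidegrees D. C x \<mu> \<gamma> * ?m \<gamma> y))"
      unfolding f_def using C[unfolded local_coeffs_def]
      by (intro sum.cong refl arg_cong2[where f = "(*)"]) blast
    also have "\<dots> = (\<Sum>\<gamma>\<in>multidegrees D. c x \<gamma> * ?m \<gamma> y)"
      unfolding c_def by (simp add: sum_distrib_left sum_distrib_right mult.assoc sum.swap[of _ B])
    finally show "f (($) (x + (\<Sum>j\<in>UNIV. y j *\<^sub>R v x j))) = (\<Sum>\<gamma>\<in>multidegrees D. c x \<gamma> * ?m \<gamma> y)" .
  qed
  moreover have "c x \<gamma> = 0" if "x \<in> U" "\<forall>i. \<gamma> i < b x i" for x \<gamma>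
    using a(2) that unfolding c_def K_def by (fastforce simp: mult.commute)
  ultimately show ?thesis by blast
qed

text \<open>If the bound failed, a nonzero polynomial of degree at most \<open>D\<close> would
  satisfy all conditions, and \<open>many\<close> would force more than \<open>D\<close> zeros, with
  multiplicity, on a nonzero transverse coefficient along some line.\<close>

lemma handicap_dimension_bound:
  fixes U :: "(real ^ 'n::finite) set" and v :: "real ^ 'n \<Rightarrow> 'n \<Rightarrow> real ^ 'n"
    and \<alpha> :: "real ^ 'n \<Rightarrow> int" and t :: "real ^ 'n \<Rightarrow> 'n \<Rightarrow> int"
  assumes U: "finite U" "U \<noteq> {}" and D: "CARD('n) * E \<le> D"
    and v: "\<And>x z. x \<in> U \<Longrightarrow> \<exists>y. z = (\<Sum>j\<in>UNIV. y j *\<^sub>R v x j)"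
    and many: "\<And>x i. x \<in> U \<Longrightarrow> D < (\<Sum>x' | x' \<in> U \<and> (\<exists>s. x' = x + s *\<^sub>R v x i). nat (\<alpha> x' + t x i))"
  shows "(E + 1) ^ CARD('n) \<le> (\<Sum>x\<in>U. \<Prod>i\<in>UNIV. nat (\<alpha> x + t x i))"
proof (rule ccontr)
  assume "\<not> ?thesis"
  then have less: "(\<Sum>x\<in>U. \<Prod>i\<in>UNIV. nat (\<alpha> x + t x i)) < (E + 1) ^ CARD('n)" by simp
  from polynomial_with_vanishing_local_coeffs[OF U(1) D less, where v = v]
  obtain f c where f: "poly_fun D f" "\<exists>y. f y \<noteq> 0"
    and c: "\<forall>x\<in>U. local_coeffs D f x (v x) (c x)"
    and c0: "\<forall>x\<in>U. \<forall>\<gamma>. (\<forall>i. \<gamma> i < nat (\<alpha> x + t x i)) \<longrightarrow> c x \<gamma> = 0"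
    by blast
  have "\<forall>x\<in>U. \<exists>\<gamma>. \<gamma> \<in> multidegrees D \<and> c x \<gamma> \<noteq> 0 \<and> vanishes_to_order f x (sum \<gamma> UNIV)"
  proof
    fix x assume x: "x \<in> U"
    show "\<exists>\<gamma>. \<gamma> \<in> multidegrees D \<and> c x \<gamma> \<noteq> 0 \<and> vanishes_to_order f x (sum \<gamma> UNIV)"
      unfolding Bex_def[symmetric]
    proof (rule leading_local_coeff)
      show "local_coeffs D f x (v x) (c x)" using c x by (rule bspec)
      show "\<exists>y. z = (\<Sum>j\<in>UNIV. y j *\<^sub>R v x j)" for z using x by (rule v)
    qed (rule f(2))
  qed
  then obtain \<gamma> where \<gamma>: "\<And>x. x \<in> U \<Longrightarrow> \<gamma> x \<in> multidegrees D" "\<And>x. x \<in> U \<Longrightarrow> c x (\<gamma> x) \<noteq> 0"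
    "\<And>x. x \<in> U \<Longrightarrow> vanishes_to_order f x (sum (\<gamma> x) UNIV)" by metis
  \<comment> \<open>At a point minimising the vanishing order relative to the handicap, a leading coefficient
    survives; it lies outside the box of imposed conditions, so in some direction \<open>i\<close> the exponent
    is large, and the order of vanishing along the \<open>i\<close>-th line is too large everywhere.\<close>
  let ?\<phi> = "\<lambda>x. int (sum (\<gamma> x) UNIV) - \<alpha> x"
  obtain x where x: "x \<in> U" "\<And>x'. x' \<in> U \<Longrightarrow> ?\<phi> x \<le> ?\<phi> x'"
    using ex_min_if_finite[of "?\<phi> ` U"] U by (force simp: not_less)
  obtain i where i: "nat (\<alpha> x + t x i) \<le> \<gamma> x i" using c0 \<gamma>(2)[OF x(1)] x(1) by (meson not_le)
  define \<delta> where "\<delta> = \<gamma> x"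
  define H where "H = {\<gamma>'. \<gamma>' \<in> multidegrees D \<and> (\<forall>j\<in>UNIV - {i}. \<gamma>' j = \<delta> j)}"
  define h where "h = (\<Sum>\<gamma>'\<in>H. monom (c x \<gamma>') (\<gamma>' i))"
  have finH: "finite H" by (simp add: H_def finite_multidegrees)
  \<comment> \<open>Only \<open>\<delta>\<close> itself contributes here, so \<open>h\<close>
    inherits the nonzero leading coefficient at \<open>x\<close>.\<close>
  have "coeff h (\<delta> i) = (\<Sum>\<gamma>' | \<gamma>' \<in> H \<and> \<gamma>' i = \<delta> i. c x \<gamma>')"
    unfolding h_def by (simp add: coeff_sum sum.inter_filter[OF finH])
  also have "{\<gamma>'. \<gamma>' \<in> H \<and> \<gamma>' i = \<delta> i} = {\<delta>}"
  proof -
    have "\<gamma>' = \<delta>" if "\<gamma>' \<in> H" "\<gamma>' i = \<delta> i" for \<gamma>'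
    proof
      show "\<gamma>' j = \<delta> j" for j using that by (cases "j = i") (simp_all add: H_def)
    qed
    moreover have "\<delta> \<in> H" using \<gamma>(1)[OF x(1)] by (simp add: H_def \<delta>_def)
    ultimately show ?thesis by blast
  qed
  finally have h0: "h \<noteq> 0" using \<gamma>(2)[OF x(1)] by (auto simp: \<delta>_def)
  have deg: "degree h \<le> D"
    unfolding h_def
  proof (rule degree_sum_le[OF finH])
    show "degree (monom (c x \<gamma>') (\<gamma>' i)) \<le> D" if "\<gamma>' \<in> H" for \<gamma>'
      using that multidegree_le[of \<gamma>' D i] degree_monom_le[of "c x \<gamma>'" "\<gamma>' i"] by (simp add: H_def)
  qed
  let ?S = "{x'. x' \<in> U \<and> (\<exists>s. x' = x + s *\<^sub>R v x i)}"
  have "\<forall>x'\<in>?S. \<exists>s. x' = x + s *\<^sub>R v x i" by blast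
  then obtain r where r: "\<forall>x'\<in>?S. x' = x + r x' *\<^sub>R v x i" by (rule bchoice[THEN exE])
  have "inj_on r ?S"
  proof (rule inj_onI)
    fix x1 x2 assume "x1 \<in> ?S" "x2 \<in> ?S" "r x1 = r x2"
    then show "x1 = x2" using bspec[OF r, of x1] bspec[OF r, of x2] by (simp only:)
  qed
  moreover have "[:- r x', 1:] ^ nat (\<alpha> x' + t x i) dvd h" if "x' \<in> ?S" for x'
  proof -
    have "x' \<in> U" using that by blast
    with \<gamma>(3) have "vanishes_to_order f x' (sum (\<gamma> x') UNIV)" by blast
    then have "vanishes_to_order f (x + r x' *\<^sub>R v x i) (sum (\<gamma> x') UNIV)"
      by (subst bspec[OF r that, symmetric])
    from vanishing_on_line[OF bspec[OF c x(1)] f(1) this, of \<delta>]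
    have dvd: "[:- r x', 1:] ^ (sum (\<gamma> x') UNIV - sum \<delta> (UNIV - {i})) dvd h" unfolding h_def H_def .
    \<comment> \<open>Minimality of \<open>x\<close> bounds the difference of the two orders below
      by \<open>\<alpha> x' - \<alpha> x\<close>, and \<open>\<gamma> x i\<close> is at least
      \<open>\<alpha> x + t x i\<close>. On adding, the handicap of \<open>x\<close> cancels and the
      share of \<open>x'\<close> remains.\<close>
    have "sum (\<gamma> x) UNIV = \<gamma> x i + sum \<delta> (UNIV - {i})" by (simp add: sum.remove[of UNIV i] \<delta>_def)
    moreover have "?\<phi> x \<le> ?\<phi> x'" using x(2) that by simp
    ultimately have "nat (\<alpha> x' + t x i) \<le> sum (\<gamma> x') UNIV - sum \<delta> (UNIV - {i})" using i by linarith
    then show ?thesis using dvd by (meson dvd_trans le_imp_power_dvd)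
  qed
  ultimately have "(\<Sum>x'\<in>?S. nat (\<alpha> x' + t x i)) \<le> degree h"
    using U by (intro sum_root_orders_le_degree[OF h0]) auto
  from order.strict_trans2[OF many[OF x(1), of i] order_trans[OF this deg]] show False by simp
qed

section \<open>Choosing the handicaps\<close>

text \<open>The subtraction is truncated. With handicaps at most \<open>M\<close>, the number \<open>s - M\<close> plays the role
  of the possibly negative integer \<open>t\<close> above.\<close>

definition threshold :: "nat \<Rightarrow> nat \<Rightarrow> ('p \<Rightarrow> nat) \<Rightarrow> 'p set \<Rightarrow> nat" where
  "threshold D M \<alpha> S = (LEAST s. D < (\<Sum>y\<in>S. \<alpha> y + s - M))"

definition share :: "nat \<Rightarrow> nat \<Rightarrow> ('p \<Rightarrow> nat) \<Rightarrow> 'p set \<Rightarrow> 'p \<Rightarrow> nat" where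
  "share D M \<alpha> S x = \<alpha> x + threshold D M \<alpha> S - M"

lemma sum_share_gt:
  assumes "finite S" "S \<noteq> {}"
  shows "D < (\<Sum>y\<in>S. share D M \<alpha> S y)"
proof -
  obtain x where x: "x \<in> S" using assms by blast
  \<comment> \<open>A witness for the \<open>LEAST\<close>: with \<open>s = M + D + 1\<close> a
    single point already exceeds \<open>D\<close>.\<close>
  have "D < \<alpha> x + (M + D + 1) - M" by simp
  also have "\<dots> \<le> (\<Sum>y\<in>S. \<alpha> y + (M + D + 1) - M)"
    using assms x by (intro member_le_sum) auto
  finally show ?thesis unfolding share_def threshold_def by (rule LeastI)
qed

text \<open>At threshold \<open>0\<close> all shares would vanish, since handicaps are at most
  \<open>M\<close>. So there is a predecessor, where leastness keeps the total at most
  \<open>D\<close>.\<close>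

lemma threshold_pred:
  assumes "finite S" "S \<noteq> {}" "\<And>y. y \<in> S \<Longrightarrow> \<alpha> y \<le> M"
  obtains s where "threshold D M \<alpha> S = Suc s" "(\<Sum>y\<in>S. \<alpha> y + s - M) \<le> D"
proof (cases "threshold D M \<alpha> S")
  case 0
  then have "D < (\<Sum>y\<in>S. \<alpha> y - M)" using sum_share_gt[OF assms(1,2), of D M \<alpha>] by (simp add: share_def)
  then show ?thesis using assms(3) by simp
next
  case (Suc s)
  then have "\<not> D < (\<Sum>y\<in>S. \<alpha> y + s - M)" unfolding threshold_def by (intro not_less_Least) simp
  then show ?thesis using Suc that by simp
qed

lemma sum_share_le:
  assumes "finite S" "S \<noteq> {}" "\<And>y. y \<in> S \<Longrightarrow> \<alpha> y \<le> M"
  shows "(\<Sum>y\<in>S. share D M \<alpha> S y) \<le> D + card S"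
proof -
  obtain s where s: "threshold D M \<alpha> S = Suc s" "(\<Sum>y\<in>S. \<alpha> y + s - M) \<le> D"
    using threshold_pred[OF assms] .
  have "(\<Sum>y\<in>S. share D M \<alpha> S y) \<le> (\<Sum>y\<in>S. (\<alpha> y + s - M) + 1)"
    by (intro sum_mono) (simp add: share_def s)
  also have "\<dots> = (\<Sum>y\<in>S. \<alpha> y + s - M) + card S" unfolding sum.distrib by simp
  finally show ?thesis using s by linarith
qed

text \<open>One step below the threshold a single share is at most the total \<open>D\<close>. This
  dictates the block length \<open>D + 1\<close> in \<open>handicap_exists\<close>.\<close>

lemma share_le:
  assumes "finite S" "x \<in> S" "\<And>y. y \<in> S \<Longrightarrow> \<alpha> y \<le> M"
  shows "share D M \<alpha> S x \<le> D + 1"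
proof -
  obtain s where s: "threshold D M \<alpha> S = Suc s" "(\<Sum>y\<in>S. \<alpha> y + s - M) \<le> D"
    by (rule threshold_pred[of S \<alpha> M D]) (use assms in auto)
  have "\<alpha> x + s - M \<le> (\<Sum>y\<in>S. \<alpha> y + s - M)" using assms by (intro member_le_sum) auto
  then show ?thesis using s by (simp add: share_def)
qed

text \<open>With larger handicaps the old threshold still suffices, so the least one can only
  drop.\<close>

lemma threshold_antimono:
  assumes "finite S" "S \<noteq> {}" "\<And>y. y \<in> S \<Longrightarrow> \<alpha> y \<le> \<alpha>' y"
  shows "threshold D M \<alpha>' S \<le> threshold D M \<alpha> S"
proof -
  have "D < (\<Sum>y\<in>S. \<alpha> y + threshold D M \<alpha> S - M)"
    using sum_share_gt[OF assms(1,2)] by (simp add: share_def)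
  also have "\<dots> \<le> (\<Sum>y\<in>S. \<alpha>' y + threshold D M \<alpha> S - M)"
    using assms(3) by (intro sum_mono) (simp add: diff_le_mono)
  finally show ?thesis unfolding threshold_def[of D M \<alpha>'] by (rule Least_le)
qed

text \<open>An extremal argument: a handicap of largest total is taken among those whose products
  respect the targets \<open>c\<close>. The geometry enters only through \<open>dim\<close>; the
  added \<open>1\<close> makes up for handicaps being integers.\<close>

lemma handicap_exists:
  fixes J :: "'p set" and \<L> :: "'n::finite \<Rightarrow> 'p set set" and c :: "'p \<Rightarrow> real"
  assumes J: "finite J" and fin: "\<And>i. finite (\<L> i)"
    and cover: "\<And>x i. x \<in> J \<Longrightarrow> \<exists>l\<in>\<L> i. x \<in> l"
    and dim: "\<And>U (\<alpha> :: 'p \<Rightarrow> int) t l. \<lbrakk>U \<subseteq> J; U \<noteq> {}; \<And>x i. x \<in> U \<Longrightarrow> l x i \<in> \<L> i \<and> x \<in> l x i;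
        \<And>x i. x \<in> U \<Longrightarrow> D < (\<Sum>y\<in>U \<inter> l x i. nat (\<alpha> y + t x i))\<rbrakk>
      \<Longrightarrow> N \<le> (\<Sum>x\<in>U. \<Prod>i\<in>UNIV. nat (\<alpha> x + t x i))"
    and c: "\<And>x. x \<in> J \<Longrightarrow> 0 \<le> c x" "sum c J < real N"
  shows "\<exists>b :: 'n \<Rightarrow> 'p \<Rightarrow> nat. (\<forall>x\<in>J. c x \<le> real (\<Prod>i\<in>UNIV. b i x + 1)) \<and>
    (\<forall>i. (\<Sum>x\<in>J. card {l \<in> \<L> i. x \<in> l} * (b i x + 1)) \<le> card (\<L> i) * (D + 2 * card J))"
proof -
  \<comment> \<open>Below \<open>M\<close> there are \<open>card J + 1\<close> blocks of length
    \<open>D + 1\<close>, so at least one block contains no handicap.\<close>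
  define M where "M = (card J + 1) * (D + 1)"
  \<comment> \<open>The minimum is attained by some line, as \<open>dim\<close> needs, and is at
    most the share from every other line, as the double count at the end needs.\<close>
  define \<beta> where "\<beta> \<alpha> i x = Min ((\<lambda>l. share D M \<alpha> (J \<inter> l) x) ` {l \<in> \<L> i. x \<in> l})" for \<alpha> i x
  define W where "W \<alpha> x = (\<Prod>i\<in>UNIV. \<beta> \<alpha> i x)" for \<alpha> x
  \<comment> \<open>Points of handicap zero are exempt from the constraint, so that the zero
    handicap is admissible.\<close>
  define A where "A = {\<alpha>. (\<forall>x\<in>J. \<alpha> x \<le> M) \<and> (\<forall>x\<in>J. 0 < \<alpha> x \<longrightarrow> real (W \<alpha> x) \<le> c x)}"
  have \<beta>_le: "\<beta> \<alpha> i x \<le> share D M \<alpha> (J \<inter> l) x" if "l \<in> \<L> i" "x \<in> l" for \<alpha> i x l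
    unfolding \<beta>_def using that fin[of i] by (intro Min_le) auto
  have \<beta>_ex: "\<exists>l\<in>\<L> i. x \<in> l \<and> share D M \<alpha> (J \<inter> l) x = \<beta> \<alpha> i x" if "x \<in> J" for \<alpha> i x
  proof -
    have "\<beta> \<alpha> i x \<in> (\<lambda>l. share D M \<alpha> (J \<inter> l) x) ` {l \<in> \<L> i. x \<in> l}"
      unfolding \<beta>_def using cover[OF that, of i] fin[of i] by (intro Min_in) auto
    then show ?thesis by auto
  qed
  have "(\<lambda>_. 0) \<in> A" by (simp add: A_def)
  moreover have "sum \<alpha> J < card J * M + 1" if "\<alpha> \<in> A" for \<alpha>
    using sum_bounded_above[of J \<alpha> M] that by (simp add: A_def)
  ultimately obtain \<alpha> where \<alpha>: "\<alpha> \<in> A" and max: "\<And>\<alpha>'. \<alpha>' \<in> A \<Longrightarrow> sum \<alpha>' J \<le> sum \<alpha> J"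
    using ex_has_greatest_nat[of "\<lambda>\<alpha>. \<alpha> \<in> A" "\<lambda>_. 0" "\<lambda>\<alpha>. sum \<alpha> J" "card J * M + 1"] by blast
  have \<alpha>M: "\<alpha> x \<le> M" if "x \<in> J" for x using \<alpha> that by (simp add: A_def)
  have \<alpha>W: "real (W \<alpha> x) \<le> c x" if "x \<in> J" "0 < \<alpha> x" for x using \<alpha> that by (simp add: A_def)
  \<comment> \<open>A point whose handicap reaches \<open>M\<close> would lie above a gap of width \<open>D + 1\<close> in the handicaps;
    the points above the gap receive the whole share of each of their lines, so they satisfy the
    dimension bound on their own although their products are at most \<open>c\<close>.\<close>
  have lt: "\<alpha> p < M" if p: "p \<in> J" for p
  proof (rule ccontr)
    assume "\<not> \<alpha> p < M"
    then have pM: "\<alpha> p = M" using \<alpha>M[OF p] by simp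
    let ?g = "\<lambda>y. \<alpha> y div (D + 1)"
    have "\<not> {..card J} \<subseteq> ?g ` J"
    proof
      assume "{..card J} \<subseteq> ?g ` J"
      then have "card {..card J} \<le> card (?g ` J)" using J by (intro card_mono) auto
      also have "\<dots> \<le> card J" by (rule card_image_le[OF J])
      finally show False by simp
    qed
    then obtain k where k: "k \<le> card J" "\<And>y. y \<in> J \<Longrightarrow> ?g y \<noteq> k" by auto
    define U where "U = {y \<in> J. k < ?g y}"
    have "?g p = card J + 1" unfolding pM M_def by (rule nonzero_mult_div_cancel_right) simp
    then have "p \<in> U" using k p by (simp add: U_def)
    have UJ: "U \<subseteq> J" by (auto simp: U_def)
    have above: "(k + 1) * (D + 1) \<le> \<alpha> x" if "x \<in> U" for x
    proof -
      have "(k + 1) * (D + 1) \<le> ?g x * (D + 1)" using that by (intro mult_right_mono) (auto simp: U_def)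
      then show ?thesis using div_times_less_eq_dividend[of "\<alpha> x" "D + 1"] by linarith
    qed
    have below: "\<alpha> y < k * (D + 1)" if "y \<in> J - U" for y
    proof -
      have "?g y < k" using that k(2)[of y] by (auto simp: U_def)
      then show ?thesis by (simp add: div_less_iff_less_mult)
    qed
    have "\<forall>x i. \<exists>l. x \<in> U \<longrightarrow> l \<in> \<L> i \<and> x \<in> l \<and> share D M \<alpha> (J \<inter> l) x = \<beta> \<alpha> i x"
      using \<beta>_ex UJ by blast
    then obtain l where l: "\<And>x i. x \<in> U \<Longrightarrow> l x i \<in> \<L> i \<and> x \<in> l x i"
      "\<And>x i. x \<in> U \<Longrightarrow> share D M \<alpha> (J \<inter> l x i) x = \<beta> \<alpha> i x" by metis
    define t where "t x i = int (threshold D M \<alpha> (J \<inter> l x i)) - int M" for x i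
    have nat_eq: "nat (int (\<alpha> y) + t x i) = share D M \<alpha> (J \<inter> l x i) y" for x y i
      unfolding t_def share_def by linarith
    have "N \<le> (\<Sum>x\<in>U. \<Prod>i\<in>UNIV. nat (int (\<alpha> x) + t x i))"
    proof (rule dim[OF UJ _ l(1)])
      show "U \<noteq> {}" using \<open>p \<in> U\<close> by blast
      fix x i assume x: "x \<in> U"
      let ?S = "J \<inter> l x i"
      have xS: "x \<in> ?S" using x l(1) UJ by blast
      \<comment> \<open>The share of \<open>x\<close> is at most \<open>D + 1\<close>, and
        \<open>y\<close> lies more than \<open>D + 1\<close> below \<open>x\<close> in handicap, so
        its truncated share is zero.\<close>
      have zero: "share D M \<alpha> ?S y = 0" if "y \<in> ?S - U \<inter> l x i" for y
      proof -
        have "share D M \<alpha> ?S x \<le> D + 1" using J \<alpha>M xS by (intro share_le) auto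
        moreover have "\<alpha> y < k * (D + 1)" using that below by blast
        ultimately show ?thesis using above[OF x] unfolding share_def by (simp add: algebra_simps)
      qed
      have "D < (\<Sum>y\<in>?S. share D M \<alpha> ?S y)" using J xS by (intro sum_share_gt) auto
      also have "\<dots> = (\<Sum>y\<in>U \<inter> l x i. share D M \<alpha> ?S y)"
      proof (rule sum.mono_neutral_right)
        show "\<forall>y\<in>?S - U \<inter> l x i. share D M \<alpha> ?S y = 0" using zero by (rule ballI)
      qed (use J UJ in auto)
      finally show "D < (\<Sum>y\<in>U \<inter> l x i. nat (int (\<alpha> y) + t x i))" by (simp only: nat_eq)
    qed
    then have "N \<le> (\<Sum>x\<in>U. W \<alpha> x)" using l(2) by (simp add: nat_eq W_def)
    then have "real N \<le> (\<Sum>x\<in>U. real (W \<alpha> x))" using of_nat_mono by fastforce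
    \<comment> \<open>Handicaps above the gap are positive, so admissibility of
      \<open>\<alpha>\<close> applies to all of \<open>U\<close>.\<close>
    also have "\<dots> \<le> sum c U" using UJ above by (intro sum_mono \<alpha>W) fastforce+
    also have "\<dots> \<le> sum c J" using J UJ c(1) by (intro sum_mono2) auto
    finally show False using c(2) by simp
  qed
  have "c x \<le> real (\<Prod>i\<in>UNIV. \<beta> \<alpha> i x + 1)" if x: "x \<in> J" for x
  proof -
    \<comment> \<open>By maximality, raising one handicap breaks admissibility. The bound
      \<open>M\<close> still holds, so some product exceeds its target; thresholds only drop, hence
      this cannot happen at a point other than \<open>x\<close>.\<close>
    define \<alpha>' where "\<alpha>' = \<alpha>(x := Suc (\<alpha> x))"
    have mono: "threshold D M \<alpha>' (J \<inter> l) \<le> threshold D M \<alpha> (J \<inter> l)" if "J \<inter> l \<noteq> {}" for l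
      using J that by (intro threshold_antimono) (auto simp: \<alpha>'_def)
    have "sum \<alpha>' J = Suc (sum \<alpha> J)" using J x by (simp add: \<alpha>'_def sum.remove[of J x])
    then have "\<alpha>' \<notin> A" using max[of \<alpha>'] by auto
    moreover have "\<forall>y\<in>J. \<alpha>' y \<le> M" using \<alpha>M lt[OF x] by (simp add: \<alpha>'_def)
    ultimately obtain y where y: "y \<in> J" "0 < \<alpha>' y" "c y < real (W \<alpha>' y)" by (auto simp: A_def not_le)
    have "y = x"
    proof (rule ccontr)
      assume yx: "y \<noteq> x"
      have "\<beta> \<alpha>' i y \<le> \<beta> \<alpha> i y" for i
      proof -
        obtain l where l: "l \<in> \<L> i" "y \<in> l" "share D M \<alpha> (J \<inter> l) y = \<beta> \<alpha> i y" using \<beta>_ex[OF y(1)] by blast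
        have "\<beta> \<alpha>' i y \<le> share D M \<alpha>' (J \<inter> l) y" using l by (intro \<beta>_le)
        also have "\<dots> \<le> share D M \<alpha> (J \<inter> l) y"
        proof -
          have "threshold D M \<alpha>' (J \<inter> l) \<le> threshold D M \<alpha> (J \<inter> l)" using l y(1) by (intro mono) blast
          moreover have "\<alpha>' y = \<alpha> y" using yx by (simp add: \<alpha>'_def)
          ultimately show ?thesis unfolding share_def by linarith
        qed
        finally show ?thesis using l by simp
      qed
      then have "W \<alpha>' y \<le> W \<alpha> y" unfolding W_def by (intro prod_mono) auto
      moreover have "real (W \<alpha> y) \<le> c y" using y yx by (intro \<alpha>W) (auto simp: \<alpha>'_def)
      ultimately show False using y(3) by linarith
    qed
    \<comment> \<open>At \<open>x\<close> itself a unit step in the handicap raises each share by at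
      most one.\<close>
    have "\<beta> \<alpha>' i x \<le> \<beta> \<alpha> i x + 1" for i
    proof -
      obtain l where l: "l \<in> \<L> i" "x \<in> l" "share D M \<alpha> (J \<inter> l) x = \<beta> \<alpha> i x" using \<beta>_ex[OF x] by blast
      have "\<beta> \<alpha>' i x \<le> share D M \<alpha>' (J \<inter> l) x" using l by (intro \<beta>_le)
      also have "\<dots> \<le> share D M \<alpha> (J \<inter> l) x + 1"
      proof -
        have "threshold D M \<alpha>' (J \<inter> l) \<le> threshold D M \<alpha> (J \<inter> l)" using l x by (intro mono) blast
        moreover have "\<alpha>' x = \<alpha> x + 1" by (simp add: \<alpha>'_def)
        ultimately show ?thesis unfolding share_def by linarith
      qed
      finally show ?thesis using l by simp
    qed
    then have "W \<alpha>' x \<le> (\<Prod>i\<in>UNIV. \<beta> \<alpha> i x + 1)" unfolding W_def by (intro prod_mono) auto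
    then show ?thesis using y(3) \<open>y = x\<close> by (meson le_less_trans less_imp_le of_nat_mono order_trans)
  qed
  \<comment> \<open>Double counting of incidences. On each line, one \<open>card J\<close> pays for
    the excess of the shares over \<open>D\<close>, the other for the added ones.\<close>
  moreover have "(\<Sum>x\<in>J. card {l \<in> \<L> i. x \<in> l} * (\<beta> \<alpha> i x + 1)) \<le> card (\<L> i) * (D + 2 * card J)" for i
  proof -
    have "(\<Sum>x\<in>J. card {l \<in> \<L> i. x \<in> l} * (\<beta> \<alpha> i x + 1)) =
        (\<Sum>x\<in>J. \<Sum>l | l \<in> \<L> i \<and> x \<in> l. \<beta> \<alpha> i x + 1)" by simp
    also have "\<dots> \<le> (\<Sum>x\<in>J. \<Sum>l | l \<in> \<L> i \<and> x \<in> l. share D M \<alpha> (J \<inter> l) x + 1)"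
      using \<beta>_le by (intro sum_mono) auto
    also have "\<dots> = (\<Sum>l\<in>\<L> i. \<Sum>x | x \<in> J \<and> x \<in> l. share D M \<alpha> (J \<inter> l) x + 1)"
      by (rule sum.swap_restrict[OF J fin])
    also have "\<dots> \<le> (\<Sum>l\<in>\<L> i. D + 2 * card J)"
    proof (rule sum_mono)
      fix l
      show "(\<Sum>x | x \<in> J \<and> x \<in> l. share D M \<alpha> (J \<inter> l) x + 1) \<le> D + 2 * card J"
      proof (cases "J \<inter> l = {}")
        case True
        then have "{x. x \<in> J \<and> x \<in> l} = {}" by blast
        then show ?thesis by (simp only: sum.empty le0)
      next
        case False
        have eq: "{x. x \<in> J \<and> x \<in> l} = J \<inter> l" by blast
        have "(\<Sum>x\<in>J \<inter> l. share D M \<alpha> (J \<inter> l) x) \<le> D + card (J \<inter> l)"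
          using J \<alpha>M False by (intro sum_share_le) auto
        moreover have "card (J \<inter> l) \<le> card J" using J by (intro card_mono) auto
        ultimately show ?thesis unfolding eq sum.distrib by simp
      qed
    qed
    finally show ?thesis by simp
  qed
  ultimately show ?thesis by blast
qed

section \<open>Joints\<close>

lemma line_parametrization:
  assumes "is_line l" "x \<in> l"
  obtains v where "\<And>y. y \<in> l \<longleftrightarrow> (\<exists>s. y = x + s *\<^sub>R v)"
proof -
  have "l \<noteq> {x}" using assms(1) by (auto simp: is_line_def)
  then obtain y where y: "y \<in> l" "x \<noteq> y" using assms(2) by blast
  have "l = range (\<lambda>s. x + s *\<^sub>R (y - x))"
    using line_eq_affine_hull[OF assms y] by (simp add: affine_hull_2_alt)
  then show ?thesis by (intro that[of "y - x"]) blast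
qed

lemma spanning_directions:
  fixes l :: "'n::finite \<Rightarrow> (real ^ 'n) set"
  assumes span: "span (\<Union>i. direction (l i)) = UNIV"
    and v: "\<And>i y. y \<in> l i \<longleftrightarrow> (\<exists>s. y = x + s *\<^sub>R v i)"
  shows "\<exists>y. z = (\<Sum>j\<in>UNIV. y j *\<^sub>R v j)"
proof -
  let ?T = "range (\<lambda>y. \<Sum>j\<in>UNIV. y j *\<^sub>R v j)"
  have "subspace ?T"
  proof (rule subspaceI)
    show "0 \<in> ?T" by (rule image_eqI[of _ _ "\<lambda>_. 0"]) auto
  next
    fix a b assume "a \<in> ?T" "b \<in> ?T"
    then obtain y y' where "a = (\<Sum>j\<in>UNIV. y j *\<^sub>R v j)" "b = (\<Sum>j\<in>UNIV. y' j *\<^sub>R v j)" by blast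
    then show "a + b \<in> ?T"
      by (intro image_eqI[of _ _ "\<lambda>j. y j + y' j"]) (auto simp: scaleR_add_left sum.distrib)
  next
    fix r a assume "a \<in> ?T"
    then obtain y where "a = (\<Sum>j\<in>UNIV. y j *\<^sub>R v j)" by blast
    then show "r *\<^sub>R a \<in> ?T"
      by (intro image_eqI[of _ _ "\<lambda>j. r * y j"]) (auto simp: scaleR_sum_right)
  qed
  moreover have "direction (l i) \<subseteq> ?T" for i
  proof
    fix w assume "w \<in> direction (l i)"
    then obtain p q where w: "w = p - q" "p \<in> l i" "q \<in> l i" by (auto simp: direction_def)
    then obtain s s' where "p = x + s *\<^sub>R v i" "q = x + s' *\<^sub>R v i" using v by blast
    with w(1) have "w = (s - s') *\<^sub>R v i" by (simp add: scaleR_diff_left)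
    then show "w \<in> ?T"
      by (intro image_eqI[of _ _ "\<lambda>j. if j = i then s - s' else 0"])
        (auto simp: if_distrib[of "\<lambda>r. r *\<^sub>R _"] cong: if_cong)
  qed
  ultimately have "span (\<Union>i. direction (l i)) \<subseteq> ?T" by (intro span_minimal) blast+
  then show ?thesis using span by auto
qed

text \<open>Supplies the assumption \<open>dim\<close> of \<open>handicap_exists\<close>: direction
  vectors of the chosen lines serve as the frame at each point, and transversality makes it
  span.\<close>

lemma joints_dimension_bound:
  fixes \<L> :: "'n::finite \<Rightarrow> (real ^ 'n) set set" and \<alpha> :: "real ^ 'n \<Rightarrow> int"
  assumes line: "\<And>i l. l \<in> \<L> i \<Longrightarrow> is_line l" and tr: "transversal \<L>"
    and U: "finite U" "U \<noteq> {}" and D: "CARD('n) * E \<le> D"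
    and l: "\<And>x i. x \<in> U \<Longrightarrow> l x i \<in> \<L> i \<and> x \<in> l x i"
    and many: "\<And>x i. x \<in> U \<Longrightarrow> D < (\<Sum>y\<in>U \<inter> l x i. nat (\<alpha> y + t x i))"
  shows "(E + 1) ^ CARD('n) \<le> (\<Sum>x\<in>U. \<Prod>i\<in>UNIV. nat (\<alpha> x + t x i))"
proof -
  have "\<exists>w. \<forall>y. y \<in> l x i \<longleftrightarrow> (\<exists>s. y = x + s *\<^sub>R w)" if "x \<in> U" for x i
    using line_parametrization[of "l x i" x] line l[OF that, of i] by metis
  then have "\<forall>x\<in>U. \<exists>w. \<forall>i y. y \<in> l x i \<longleftrightarrow> (\<exists>s. y = x + s *\<^sub>R w i)" by metis
  then obtain v where v: "\<forall>x\<in>U. \<forall>i y. y \<in> l x i \<longleftrightarrow> (\<exists>s. y = x + s *\<^sub>R v x i)"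
    by (rule bchoice[THEN exE])
  show ?thesis
  proof (rule handicap_dimension_bound[OF U D, where v = v])
    fix x z assume x: "x \<in> U"
    have "span (\<Union>i. direction (l x i)) = UNIV" using tr l[OF x] unfolding transversal_def by blast
    then show "\<exists>y. z = (\<Sum>j\<in>UNIV. y j *\<^sub>R v x j)"
      by (rule spanning_directions[where x = x]) (use v x in blast)
  next
    fix x i assume x: "x \<in> U"
    have "{x'. x' \<in> U \<and> (\<exists>s. x' = x + s *\<^sub>R v x i)} = U \<inter> l x i" using v x by blast
    then show "D < (\<Sum>x' | x' \<in> U \<and> (\<exists>s. x' = x + s *\<^sub>R v x i). nat (\<alpha> x' + t x i))"
      using many[OF x, of i] by (simp only:)
  qed
qed

section \<open>From handicaps to the sum over joints\<close>

lemma sum_geometric_mean_le_1: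
  fixes a :: "'n::finite \<Rightarrow> 'p \<Rightarrow> real"
  assumes "\<And>i x. x \<in> J \<Longrightarrow> 0 \<le> a i x" "\<And>i. (\<Sum>x\<in>J. a i x) \<le> 1"
  shows "(\<Sum>x\<in>J. (\<Prod>i\<in>UNIV. a i x) powr (1 / CARD('n))) \<le> 1"
proof -
  have "(\<Sum>x\<in>J. (\<Prod>i\<in>UNIV. a i x) powr (1 / CARD('n))) \<le> (\<Sum>x\<in>J. \<Sum>i\<in>UNIV. a i x / CARD('n))"
    using assms(1) by (intro sum_mono arith_geom_mean) auto
  also have "\<dots> = (\<Sum>i\<in>UNIV. (\<Sum>x\<in>J. a i x) / CARD('n))"
    by (subst sum.swap) (simp add: sum_divide_distrib)
  also have "\<dots> \<le> (\<Sum>i\<in>(UNIV::'n set). 1 / CARD('n))"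
    using assms(2) by (intro sum_mono divide_right_mono) auto
  finally show ?thesis by simp
qed

lemma joint_on_lines:
  assumes "x \<in> joints \<L>"
  shows "\<exists>l\<in>\<L> i. x \<in> l"
proof -
  have "{l \<in> \<L> i. x \<in> l} \<noteq> {}"
    using assms unfolding joints_def lines_through_def by (metis (mono_tags, lifting) card.empty mem_Collect_eq not_one_le_zero)
  then show ?thesis by blast
qed

lemma multijoints_bound:
  fixes \<L> :: "'n::finite \<Rightarrow> (real ^ 'n) set set"
  assumes n: "CARD('n) \<ge> 2" and fin: "\<And>i. finite (\<L> i)"
    and line: "\<And>i l. l \<in> \<L> i \<Longrightarrow> is_line l" and tr: "transversal \<L>"
  shows "(\<Sum>x\<in>joints \<L>. (\<Prod>i\<in>UNIV. real (lines_through (\<L> i) x)) powr (1 / (real CARD('n) - 1)))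
    \<le> ((real CARD('n) + 2) ^ CARD('n)) powr (1 / (real CARD('n) - 1)) *
      (\<Prod>i\<in>UNIV. real (card (\<L> i))) powr (1 / (real CARD('n) - 1))"
proof (cases "joints \<L> = {}")
  case True
  then show ?thesis by simp
next
  case False
  define J where "J = joints \<L>"
  define n where "n = CARD('n)"
  define P where "P x = (\<Prod>i\<in>UNIV. real (lines_through (\<L> i) x))" for x
  define S where "S = (\<Sum>x\<in>J. P x powr (1 / (real n - 1)))"
  define Q where "Q = (\<Prod>i\<in>UNIV. real (card (\<L> i)))"
  \<comment> \<open>With \<open>E\<close> of the size of \<open>J\<close> and degree
    \<open>n * E\<close>, the error \<open>2 * card J\<close> turns the degree into
    \<open>(n + 2) * E\<close>, which produces the constant.\<close>
  define E where "E = card J"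
  \<comment> \<open>The targets are proportional to the summands and normalised to total
    \<open>E ^ n\<close>, just below the dimension bound \<open>(E + 1) ^ n\<close>.\<close>
  define c where "c x = E ^ n * P x powr (1 / (real n - 1)) / S" for x
  have n2: "2 \<le> n" using n by (simp add: n_def)
  have J: "finite J" "J \<noteq> {}" using False finite_joints[OF n fin line tr] by (auto simp: J_def)
  have E: "E > 0" using J by (simp add: E_def card_gt_0_iff)
  have P: "P x \<ge> 1" if "x \<in> J" for x
    unfolding P_def using that by (intro prod_ge_1) (simp add: J_def joints_def)
  have S: "S > 0" unfolding S_def using J P by (intro sum_pos) force+
  have Li: "card (\<L> i) > 0" for i
    using J joint_on_lines[of _ \<L> i] fin[of i] by (auto simp: card_gt_0_iff J_def)
  have Q: "Q > 0" unfolding Q_def using Li by (intro prod_pos) auto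
  have "sum c J = E ^ n"
    unfolding c_def using S by (simp add: S_def flip: sum_divide_distrib sum_distrib_left)
  also have "\<dots> < real ((E + 1) ^ n)" using n2 by (simp add: power_strict_mono)
  finally have sumc: "sum c J < real ((E + 1) ^ n)" .
  have "\<exists>b :: 'n \<Rightarrow> real ^ 'n \<Rightarrow> nat. (\<forall>x\<in>J. c x \<le> real (\<Prod>i\<in>UNIV. b i x + 1)) \<and>
      (\<forall>i. (\<Sum>x\<in>J. card {l \<in> \<L> i. x \<in> l} * (b i x + 1)) \<le> card (\<L> i) * (n * E + 2 * card J))"
  proof (rule handicap_exists[OF J(1) fin _ _ _ sumc])
    show "\<exists>l\<in>\<L> i. x \<in> l" if "x \<in> J" for x i
      using that unfolding J_def by (rule joint_on_lines)
    show "0 \<le> c x" for x using S by (simp add: c_def)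
    fix U :: "(real ^ 'n) set" and \<alpha> :: "real ^ 'n \<Rightarrow> int" and t :: "real ^ 'n \<Rightarrow> 'n \<Rightarrow> int" and l
    assume U: "U \<subseteq> J" "U \<noteq> {}" and *: "\<And>x i. x \<in> U \<Longrightarrow> l x i \<in> \<L> i \<and> x \<in> l x i"
      "\<And>x i. x \<in> U \<Longrightarrow> n * E < (\<Sum>y\<in>U \<inter> l x i. nat (\<alpha> y + t x i))"
    have "CARD('n) * E \<le> n * E" by (simp add: n_def)
    then show "(E + 1) ^ n \<le> (\<Sum>x\<in>U. \<Prod>i\<in>UNIV. nat (\<alpha> x + t x i))"
      unfolding n_def[symmetric]
      by (intro joints_dimension_bound[where \<L> = \<L> and l = l and D = "n * E" and E = E, folded n_def])
        (use line tr finite_subset[OF U(1) J(1)] U(2) * in \<open>assumption | blast\<close>)+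
  qed
  then obtain b where b: "\<And>x. x \<in> J \<Longrightarrow> c x \<le> real (\<Prod>i\<in>UNIV. b i x + 1)"
    "\<And>i. (\<Sum>x\<in>J. card {l \<in> \<L> i. x \<in> l} * (b i x + 1)) \<le> card (\<L> i) * (n * E + 2 * card J)" by blast
  \<comment> \<open>Normalised so that each \<open>a i\<close> has total at most one, as the AM-GM
    lemma requires.\<close>
  define a where "a i x = real (lines_through (\<L> i) x) * real (b i x + 1) / (real (card (\<L> i)) * ((real n + 2) * E))" for i x
  have a_sum: "(\<Sum>x\<in>J. a i x) \<le> 1" for i
  proof -
    have "(\<Sum>x\<in>J. real (lines_through (\<L> i) x) * real (b i x + 1)) \<le> real (card (\<L> i)) * ((real n + 2) * E)"
      using of_nat_mono[OF b(2)[of i], where 'a = real]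
      unfolding lines_through_def by (simp add: E_def algebra_simps)
    then show ?thesis
      unfolding a_def using Li[of i] E by (simp add: divide_le_eq_1 flip: sum_divide_distrib)
  qed
  define R where "R = Q * (real n + 2) ^ n"
  have R: "R > 0" using Q by (simp add: R_def)
  have "S / (S * R) powr (1 / n) = (\<Sum>x\<in>J. P x powr (1 / (real n - 1)) / (S * R) powr (1 / n))"
    by (simp add: S_def sum_divide_distrib)
  also have "\<dots> \<le> (\<Sum>x\<in>J. (\<Prod>i\<in>UNIV. a i x) powr (1 / n))"
  proof (rule sum_mono)
    fix x assume x: "x \<in> J"
    \<comment> \<open>The exponent \<open>1 / (n - 1)\<close> is the fixed point that makes the
      weight the \<open>n\<close>-th root of \<open>P x\<close> times the weight, so the geometric
      means dominate multiples of the summands of \<open>S\<close>.\<close>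
    have "P x powr (1 / (real n - 1)) = (P x * P x powr (1 / (real n - 1))) powr (1 / n)"
    proof -
      have "P x * P x powr (1 / (real n - 1)) = P x powr (1 + 1 / (real n - 1))"
        using P[OF x] by (simp add: powr_add)
      moreover have "(1 + 1 / (real n - 1)) * (1 / n) = 1 / (real n - 1)" using n2 by (simp add: field_simps)
      ultimately show ?thesis by (simp add: powr_powr)
    qed
    then have "P x powr (1 / (real n - 1)) / (S * R) powr (1 / n) =
        (P x * P x powr (1 / (real n - 1)) / (S * R)) powr (1 / n)"
      using P[OF x] S R by (simp add: powr_divide)
    \<comment> \<open>The factor \<open>E ^ n\<close> in \<open>c x\<close> cancels against the
      normalisation of \<open>a\<close>, so the final constant is free of the number of
      joints.\<close>
    also have "P x * P x powr (1 / (real n - 1)) / (S * R) = P x * c x / (Q * ((real n + 2) * E) ^ n)"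
      using E unfolding c_def R_def by (simp add: power_mult_distrib)
    also have "(\<dots>) powr (1 / n) \<le> (\<Prod>i\<in>UNIV. a i x) powr (1 / n)"
    proof (rule powr_mono2)
      have "(\<Prod>i\<in>UNIV. a i x) = P x * real (\<Prod>i\<in>UNIV. b i x + 1) / (Q * ((real n + 2) * E) ^ n)"
        unfolding a_def P_def Q_def by (simp add: prod_dividef prod.distrib n_def)
      then show "P x * c x / (Q * ((real n + 2) * E) ^ n) \<le> (\<Prod>i\<in>UNIV. a i x)"
        using b(1)[OF x] P[OF x] Q by (auto intro!: divide_right_mono mult_left_mono)
      show "0 \<le> P x * c x / (Q * ((real n + 2) * E) ^ n)" using P[OF x] S Q by (simp add: c_def)
    qed simp
    finally show "P x powr (1 / (real n - 1)) / (S * R) powr (1 / n) \<le> (\<Prod>i\<in>UNIV. a i x) powr (1 / n)" .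
  qed
  also have "\<dots> \<le> 1"
    unfolding n_def by (rule sum_geometric_mean_le_1) (simp_all add: a_sum, simp add: a_def)
  finally have "S \<le> (S * R) powr (1 / n)" using S R by (simp add: divide_le_eq)
  then have "S powr n \<le> ((S * R) powr (1 / n)) powr n" using S by (intro powr_mono2) auto
  then have "S ^ n \<le> S * R" using S R n2 by (simp add: powr_powr powr_realpow)
  \<comment> \<open>One factor \<open>S\<close>, coming from the normalisation of \<open>c\<close>,
    cancels; the \<open>(n - 1)\<close>-th root then gives the exponent of the claim.\<close>
  moreover have "S ^ n = S * S ^ (n - 1)" using n2 by (simp flip: power_Suc)
  ultimately have "S ^ (n - 1) \<le> R" using S by simp
  then have "(S ^ (n - 1)) powr (1 / (real n - 1)) \<le> R powr (1 / (real n - 1))"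
    using S n2 by (intro powr_mono2) auto
  moreover have "(S ^ (n - 1)) powr (1 / (real n - 1)) = S"
    using S n2 by (simp add: powr_powr of_nat_diff flip: powr_realpow)
  ultimately have "S \<le> Q powr (1 / (real n - 1)) * ((real n + 2) ^ n) powr (1 / (real n - 1))"
    using Q by (simp add: R_def powr_mult)
  then show ?thesis unfolding S_def P_def Q_def J_def n_def by (simp add: mult.commute)
qed

theorem theorem1p5:
  assumes "CARD('n::finite) \<ge> 2"
  shows "\<forall>\<epsilon>::real. \<epsilon> > 0 \<longrightarrow> (\<exists>C::real. \<forall>\<L> :: 'n \<Rightarrow> (real ^ 'n) set set.
    (\<forall>i. finite (\<L> i)) \<and> (\<forall>i. \<forall>l \<in> \<L> i. is_line l) \<and> transversal \<L> \<longrightarrow>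
    (\<Sum>x\<in>joints \<L>. (\<Prod>i\<in>UNIV. real (lines_through (\<L> i) x)) powr (1 / (real CARD('n) - 1)))
      \<le> C * (\<Prod>i\<in>UNIV. real (card (\<L> i))) powr (1 / (real CARD('n) - 1) + \<epsilon>))"
proof (intro allI impI)
  fix \<epsilon> :: real assume \<epsilon>: "\<epsilon> > 0"
  let ?C = "((real CARD('n) + 2) ^ CARD('n)) powr (1 / (real CARD('n) - 1))"
  have "(\<Sum>x\<in>joints \<L>. (\<Prod>i\<in>UNIV. real (lines_through (\<L> i) x)) powr (1 / (real CARD('n) - 1)))
      \<le> ?C * (\<Prod>i\<in>UNIV. real (card (\<L> i))) powr (1 / (real CARD('n) - 1) + \<epsilon>)" (is "?S \<le> _ * ?Q powr _")
    if \<L>: "\<forall>i. finite (\<L> i)" "\<forall>i. \<forall>l \<in> \<L> i. is_line l" "transversal \<L>" for \<L> :: "'n \<Rightarrow> (real ^ 'n) set set"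
  proof -
    have "?S \<le> ?C * ?Q powr (1 / (real CARD('n) - 1))"
      using \<L> by (intro multijoints_bound assms) auto
    also have "\<dots> \<le> ?C * ?Q powr (1 / (real CARD('n) - 1) + \<epsilon>)"
    proof (intro mult_left_mono)
      \<comment> \<open>The product is a natural number: either it is zero and both powers are zero,
        or it is at least one and the larger exponent gives the larger power.\<close>
      define q where "q = (\<Prod>i\<in>UNIV. card (\<L> i))"
      have Q: "?Q = real q" by (simp add: q_def)
      show "?Q powr (1 / (real CARD('n) - 1)) \<le> ?Q powr (1 / (real CARD('n) - 1) + \<epsilon>)"
        unfolding Q using \<epsilon> by (cases "q = 0") (auto intro: powr_mono)
    qed simp
    finally show ?thesis .
  qed
  then show "\<exists>C::real. \<forall>\<L> :: 'n \<Rightarrow> (real ^ 'n) set set.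
    (\<forall>i. finite (\<L> i)) \<and> (\<forall>i. \<forall>l \<in> \<L> i. is_line l) \<and> transversal \<L> \<longrightarrow>
    (\<Sum>x\<in>joints \<L>. (\<Prod>i\<in>UNIV. real (lines_through (\<L> i) x)) powr (1 / (real CARD('n) - 1)))
      \<le> C * (\<Prod>i\<in>UNIV. real (card (\<L> i))) powr (1 / (real CARD('n) - 1) + \<epsilon>)" by blast
qed

end
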